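(* Let $k,n$ be integers with $0\le k\le n$. Then for every integer $i$ with $0\le i\le n-k$, $$\sum_{l=i}^{n-k}(-1)^{l-i}\binom{n-k}{l}\frac{(k+1/2)_l}{(2k+2)_l}\binom{l}{i}=4^k\,\frac{2k+1}{n+1}\binom{n+k+1}{n}^{-1}\binom{n}{k}^{-1}\binom{2n-2i+2}{2k+2}\binom{n+1}{i}r_{n,k+i},$$ and for every integer $j$ with $0\le j\le n-k$, $$\sum_{l=j}^{n-k}\binom{2n-2l+2}{2k+2}\binom{n+1}{l}\binom{l}{j}r_{n,k+l}=4^{-k}\,\frac{n+1}{2k+1}\binom{n+k+1}{n}\binom{n}{k}\binom{n-k}{j}\frac{(k+1/2)_j}{(2k+2)_j}.$$
   Context: Notation: $(y)_0:=1$, $(y)_s:=y(y+1)\cdots(y+s-1)$ for $s\ge1$; for $0\le j\le n$, $r_{n,j}:=\binom{n}{j}^{-1}4^{-n}\binom{2j}{j}\binom{2n-2j}{n-j}$. *)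

theory Defs
  imports Complex_Main
begin

text \<open>The numbers $r_{n,j}$; meaningful for $j \le n$ only (natural-number subtraction).\<close>

definition r_coeff :: "nat \<Rightarrow> nat \<Rightarrow> real" where
  "r_coeff n j = inverse (real (n choose j)) * inverse (4 ^ n)
     * real ((2 * j) choose j) * real ((2 * n - 2 * j) choose (n - j))"

end

theory Submission
  imports Defs
begin

text \<open>
  Write $m = n - k$, $a = k + 1/2$, $c = 2k + 2$, so that $c - a = k + 3/2$. Up to an explicit
  constant, the weight $\binom{2n-2i+2}{2k+2}\binom{n+1}{i} r_{n,k+i}$ is the term
  $\binom{m}{i} (a)_i (c-a)_{m-i}$ of the Chu-Vandermonde convolution for $(c)_m$; this is seen by
  expressing every factor through factorials (lemma \<open>convolution_weight_eq\<close>).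

  After that identification, both identities are instances of Chu-Vandermonde. Since
  $\binom{m}{l}\binom{l}{i} = \binom{m}{i}\binom{m-i}{l-i}$, the factor $\binom{l}{i}$ only shifts
  the summation. What remains is, for the first identity, the alternating form
  ${}_2F_1(-p, a; c; 1) = (c-a)_p / (c)_p$ (lemma \<open>alternating_pochhammer_ratio_moment\<close>) and,
  for the second, the convolution $(a+b)_p = \sum_s \binom{p}{s} (a)_s (b)_{p-s}$ itself
  (lemma \<open>pochhammer_convolution_moment\<close>).
\<close>

text \<open>
  The reflection $(-b)_q = (-1)^q (b-q+1)_q$ with $b = c + p - 1$ turns the convolution for
  $(a - b)_p$ into this alternating sum.
\<close>

lemma chu_vandermonde_alternating:
  fixes a c :: "'a::field_char_0"
  shows "(\<Sum>s\<le>p. (-1) ^ s * of_nat (p choose s) * pochhammer a s * pochhammer (c + of_nat s) (p - s))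
    = pochhammer (c - a) p"
proof -
  define b where "b = c + of_nat p - 1"
  have "(-1) ^ p * pochhammer (c - a) p = pochhammer (a + - b) p"
    using pochhammer_minus[of "b - a" p] by (simp add: b_def algebra_simps)
  also have "\<dots> = (\<Sum>s\<le>p. of_nat (p choose s) * pochhammer a s * pochhammer (- b) (p - s))"
    by (rule pochhammer_binomial_sum)
  also have "\<dots> = (\<Sum>s\<le>p. (-1) ^ p * ((-1) ^ s * of_nat (p choose s) * pochhammer a s
      * pochhammer (c + of_nat s) (p - s)))"
  proof (rule sum.cong[OF refl])
    fix s assume "s \<in> {..p}"
    then have s: "s \<le> p" by simp
    have "b - of_nat (p - s) + 1 = c + of_nat s"
      using s by (simp add: b_def of_nat_diff)
    then have "pochhammer (- b) (p - s) = (-1) ^ (p - s) * pochhammer (c + of_nat s) (p - s)"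
      using pochhammer_minus[of b "p - s"] by simp
    moreover have "(-1) ^ (p - s) = ((-1) ^ p * (-1) ^ s :: 'a)"
      using s by (metis le_add_diff_inverse2 minus_one_power_iff even_add mult_minus1_right
          mult_1_right minus_minus)
    ultimately show "of_nat (p choose s) * pochhammer a s * pochhammer (- b) (p - s)
      = (-1) ^ p * ((-1) ^ s * of_nat (p choose s) * pochhammer a s
          * pochhammer (c + of_nat s) (p - s))"
      by simp
  qed
  finally show ?thesis
    by (simp flip: sum_distrib_left)
qed

text \<open>
  Trinomial revision pulls the $i$-th binomial moment of $\binom{m}{l} f(l)$ back to a plain
  binomial sum, to which the Chu-Vandermonde formulas apply.
\<close>

lemma binomial_moment_shift:
  fixes f :: "nat \<Rightarrow> 'a::comm_semiring_1"
  assumes "i \<le> m"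
  shows "(\<Sum>l = i..m. of_nat (m choose l) * of_nat (l choose i) * f l)
    = of_nat (m choose i) * (\<Sum>s\<le>m - i. of_nat ((m - i) choose s) * f (i + s))"
proof -
  have "(\<Sum>l = i..m. of_nat (m choose l) * of_nat (l choose i) * f l)
    = (\<Sum>l = i..m. of_nat (m choose i) * (of_nat ((m - i) choose (l - i)) * f l))"
    by (intro sum.cong refl) (auto simp: choose_mult simp flip: mult.assoc of_nat_mult)
  also have "\<dots> = (\<Sum>s\<le>m - i. of_nat (m choose i) * (of_nat ((m - i) choose s) * f (i + s)))"
    by (rule sum.reindex_bij_witness[where i = "\<lambda>s. i + s" and j = "\<lambda>l. l - i"])
      (use assms in auto)
  finally show ?thesis
    by (simp add: sum_distrib_left)
qed

text \<open>
  With the common denominator $(c)_m = (c)_{i+s} (c+i+s)_{m-i-s}$, the shifted sum is the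
  alternating Chu-Vandermonde sum for parameters $a + i$ and $c + i$, whose difference is still
  $c - a$.
\<close>

lemma alternating_pochhammer_ratio_moment:
  fixes a c :: "'a::field_char_0"
  assumes "i \<le> m" and nz: "pochhammer c m \<noteq> 0"
  shows "(\<Sum>l = i..m. (-1) ^ (l - i) * of_nat (m choose l)
        * (pochhammer a l / pochhammer c l) * of_nat (l choose i))
    = of_nat (m choose i) * pochhammer a i * pochhammer (c - a) (m - i) / pochhammer c m"
proof -
  define p where "p = m - i"
  have m: "m = i + p" using assms by (simp add: p_def)
  have "(\<Sum>l = i..m. (-1) ^ (l - i) * of_nat (m choose l)
        * (pochhammer a l / pochhammer c l) * of_nat (l choose i))
      = (\<Sum>l = i..m. of_nat (m choose l) * of_nat (l choose i)
        * ((-1) ^ (l - i) * (pochhammer a l / pochhammer c l)))"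
    by (simp add: mult_ac)
  also have "\<dots> = of_nat (m choose i) * (\<Sum>s\<le>p. of_nat (p choose s)
        * ((-1) ^ s * (pochhammer a (i + s) / pochhammer c (i + s))))"
    by (subst binomial_moment_shift) (use assms in \<open>auto simp: p_def\<close>)
  also have "(\<Sum>s\<le>p. of_nat (p choose s)
        * ((-1) ^ s * (pochhammer a (i + s) / pochhammer c (i + s))))
      = (\<Sum>s\<le>p. pochhammer a i / pochhammer c m * ((-1) ^ s * of_nat (p choose s)
          * pochhammer (a + of_nat i) s * pochhammer (c + of_nat i + of_nat s) (p - s)))"
  proof (rule sum.cong[OF refl])
    fix s assume "s \<in> {..p}"
    then have "pochhammer c m = pochhammer c (i + s) * pochhammer (c + of_nat (i + s)) (p - s)"
      by (subst pochhammer_product[of "i + s" m]) (auto simp: m)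
    moreover have "pochhammer a (i + s) = pochhammer a i * pochhammer (a + of_nat i) s"
      by (rule pochhammer_product')
    ultimately show "of_nat (p choose s)
        * ((-1) ^ s * (pochhammer a (i + s) / pochhammer c (i + s)))
      = pochhammer a i / pochhammer c m * ((-1) ^ s * of_nat (p choose s)
          * pochhammer (a + of_nat i) s * pochhammer (c + of_nat i + of_nat s) (p - s))"
      using nz by (simp add: field_simps)
  qed
  also have "\<dots> = pochhammer a i / pochhammer c m * pochhammer (c + of_nat i - (a + of_nat i)) p"
    by (simp only: chu_vandermonde_alternating flip: sum_distrib_left)
  finally show ?thesis
    by (simp add: p_def)
qed

text \<open>
  Here $(a)_{i+s} = (a)_i (a+i)_s$ leaves the convolution of $(a+i)_s$ with $(c-a)_{m-i-s}$, which
  is $(c+i)_{m-i} = (c)_m / (c)_i$.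
\<close>

lemma pochhammer_convolution_moment:
  fixes a c :: "'a::field_char_0"
  assumes "i \<le> m" and nz: "pochhammer c m \<noteq> 0"
  shows "(\<Sum>l = i..m. of_nat (m choose l) * of_nat (l choose i)
        * (pochhammer a l * pochhammer (c - a) (m - l)))
    = of_nat (m choose i) * pochhammer c m * (pochhammer a i / pochhammer c i)"
proof -
  define p where "p = m - i"
  have m: "m = i + p" using assms by (simp add: p_def)
  have "(\<Sum>l = i..m. of_nat (m choose l) * of_nat (l choose i)
        * (pochhammer a l * pochhammer (c - a) (m - l)))
      = of_nat (m choose i) * (\<Sum>s\<le>p. of_nat (p choose s)
        * (pochhammer a (i + s) * pochhammer (c - a) (p - s)))"
    by (subst binomial_moment_shift) (use assms in \<open>auto simp: p_def\<close>)
  also have "(\<Sum>s\<le>p. of_nat (p choose s) * (pochhammer a (i + s) * pochhammer (c - a) (p - s)))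
      = pochhammer a i * (\<Sum>s\<le>p. of_nat (p choose s) * pochhammer (a + of_nat i) s
          * pochhammer (c - a) (p - s))"
    by (simp add: pochhammer_product' sum_distrib_left mult_ac)
  also have "\<dots> = pochhammer a i * pochhammer (c + of_nat i) p"
    using pochhammer_binomial_sum[of "a + of_nat i" "c - a" p] by (simp add: add.commute)
  finally show ?thesis
    using nz by (auto simp: m pochhammer_product' add_ac)
qed

lemma pochhammer_half_fact:
  "pochhammer (real k + 1 / 2) i = fact (2 * k + 2 * i) * fact k / (4 ^ i * fact (2 * k) * fact (k + i))"
proof (induction i)
  case (Suc i)
  define A B where "A = real k + real i + 1" and "B = real k + 1 / 2 + real i"
  have "fact (2 * k + 2 * Suc i) = 2 * A * (2 * B) * fact (2 * k + 2 * i)"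
    "fact (k + Suc i) = A * fact (k + i)"
    by (simp_all add: A_def B_def algebra_simps)
  moreover have "A \<noteq> 0"
    unfolding A_def by linarith
  ultimately show ?case
    by (simp only: pochhammer_Suc Suc.IH power_Suc flip: B_def) (simp add: mult_ac)
qed simp

text \<open>
  The bridge between the hypergeometric and the binomial side: with $p = n - k - i$, both sides
  become the same monomial in factorials and powers of 4. The shifted half-integer symbol
  $(k + 3/2)_p$ is an instance of the preceding lemma at $k + 1$.
\<close>

lemma convolution_weight_eq:
  assumes "k \<le> n" "i \<le> n - k"
  shows "real ((n - k) choose i) * pochhammer (real k + 1 / 2) i
        * pochhammer (real k + 3 / 2) (n - k - i) / pochhammer (2 * real k + 2) (n - k)
    = 4 ^ k * ((2 * real k + 1) / (real n + 1))
        * inverse (real ((n + k + 1) choose n)) * inverse (real (n choose k))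
        * real ((2 * n - 2 * i + 2) choose (2 * k + 2)) * real ((n + 1) choose i) * r_coeff n (k + i)"
proof -
  define p where "p = n - k - i"
  have n: "n = k + i + p" using assms by (simp add: p_def)
  have args: "n + k + 1 = 2 * k + 1 + i + p" "n + 1 - i = k + p + 1"
    "2 * n - 2 * i + 2 = 2 * k + 2 * p + 2" "n - (k + i) = p" "2 * n - 2 * (k + i) = 2 * p"
    by (simp_all add: n)
  have le: "k + i \<le> n"
    by (simp add: n)
  have half: "pochhammer (real k + 3 / 2) p
      = fact (2 * k + 2 * p + 2) * fact (k + 1) / (4 ^ p * fact (2 * k + 2) * fact (k + p + 1))"
    using pochhammer_half_fact[of "k + 1" p] by (simp add: algebra_simps)
  have whole: "pochhammer (2 * real k + 2) (i + p) = fact (2 * k + 1 + i + p) / fact (2 * k + 1)"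
    using pochhammer_product'[of "1::real" "2 * k + 1" "i + p"]
    by (simp add: add_ac nonzero_eq_divide_eq mult.commute del: fact_Suc flip: pochhammer_fact)
  have "real ((i + p) choose i) = fact (i + p) / (fact i * fact p)"
    by (simp add: binomial_fact)
  moreover have "real ((n + k + 1) choose n) = fact (2 * k + 1 + i + p) / (fact n * fact (k + 1))"
    using binomial_fact[of n "n + k + 1", where 'a = real]
      arg_cong[OF args(1), of "fact :: nat \<Rightarrow> real"]
    by (simp del: fact_Suc binomial_Suc_Suc)
  moreover have "real (n choose k) = fact n / (fact k * fact (i + p))"
    using binomial_fact[of k n, where 'a = real] by (simp add: n)
  moreover have "real ((2 * n - 2 * i + 2) choose (2 * k + 2))
      = fact (2 * k + 2 * p + 2) / (fact (2 * k + 2) * fact (2 * p))"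
    using binomial_fact[of "2 * k + 2" "2 * k + 2 * p + 2", where 'a = real]
    unfolding args by (simp del: fact_Suc binomial_Suc_Suc)
  moreover have "real ((n + 1) choose i) = (real n + 1) * fact n / (fact i * fact (k + p + 1))"
    using binomial_fact[of i "n + 1", where 'a = real]
      fact_Suc[of n, where 'a = real]
    unfolding args by (simp add: n add.commute del: fact_Suc)
  moreover have "r_coeff n (k + i) = fact (k + i) * fact p / fact n / 4 ^ n
      * (fact (2 * k + 2 * i) / (fact (k + i) * fact (k + i))) * (fact (2 * p) / (fact p * fact p))"
    using binomial_fact[of "k + i" n, where 'a = real]
      binomial_fact[of "k + i" "2 * (k + i)", where 'a = real]
      binomial_fact[of p "2 * p", where 'a = real]
      le
    unfolding r_coeff_def args by (simp add: divide_inverse add.commute)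
  moreover have "fact (2 * k + 1) = (2 * real k + 1) * fact (2 * k)"
    by simp
  moreover have "n - k = i + p" "n - k - i = p"
    by (simp_all add: n)
  moreover have "(4 :: real) ^ n = 4 ^ k * 4 ^ i * 4 ^ p"
    by (simp add: n power_add)
  ultimately show ?thesis
    by (simp only: half whole pochhammer_half_fact) (simp add: divide_simps del: fact_Suc)
qed

theorem mainTheorem14:
  fixes k n :: nat
  assumes "k \<le> n"
  shows "(\<forall>i\<le>n - k.
      (\<Sum>l = i..n - k. (-1) ^ (l - i) * real ((n - k) choose l)
          * (pochhammer (real k + 1 / 2) l / pochhammer (2 * real k + 2) l) * real (l choose i))
      = 4 ^ k * ((2 * real k + 1) / (real n + 1))
          * inverse (real ((n + k + 1) choose n)) * inverse (real (n choose k))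
          * real ((2 * n - 2 * i + 2) choose (2 * k + 2)) * real ((n + 1) choose i) * r_coeff n (k + i))
  \<and> (\<forall>j\<le>n - k.
      (\<Sum>l = j..n - k. real ((2 * n - 2 * l + 2) choose (2 * k + 2))
          * real ((n + 1) choose l) * real (l choose j) * r_coeff n (k + l))
      = inverse (4 ^ k) * ((real n + 1) / (2 * real k + 1))
          * real ((n + k + 1) choose n) * real (n choose k) * real ((n - k) choose j)
          * (pochhammer (real k + 1 / 2) j / pochhammer (2 * real k + 2) j))"
proof (intro conjI allI impI)
  define P where "P = pochhammer (2 * real k + 2) (n - k)"
  have nz: "P \<noteq> 0"
    unfolding P_def by (intro less_imp_neq[symmetric] pochhammer_pos) simp
  have shift: "2 * real k + 2 - (real k + 1 / 2) = real k + 3 / 2"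
    by simp
  {
    fix i assume i: "i \<le> n - k"
    show "(\<Sum>l = i..n - k. (-1) ^ (l - i) * real ((n - k) choose l)
          * (pochhammer (real k + 1 / 2) l / pochhammer (2 * real k + 2) l) * real (l choose i))
      = 4 ^ k * ((2 * real k + 1) / (real n + 1))
          * inverse (real ((n + k + 1) choose n)) * inverse (real (n choose k))
          * real ((2 * n - 2 * i + 2) choose (2 * k + 2)) * real ((n + 1) choose i) * r_coeff n (k + i)"
      using alternating_pochhammer_ratio_moment[OF i nz[unfolded P_def], of "real k + 1 / 2"]
        convolution_weight_eq[OF assms i]
      by (simp only: shift)
  }
  fix j assume j: "j \<le> n - k"
  define C where "C = 4 ^ k * ((2 * real k + 1) / (real n + 1))
    * inverse (real ((n + k + 1) choose n)) * inverse (real (n choose k))"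
  have inverse_C: "inverse C = inverse (4 ^ k) * ((real n + 1) / (2 * real k + 1))
    * real ((n + k + 1) choose n) * real (n choose k)"
    by (simp add: C_def divide_inverse)
  have "real (n choose k) \<noteq> 0" "real ((n + k + 1) choose n) \<noteq> 0"
    using assms by simp_all
  then have C: "C \<noteq> 0"
    by (simp add: C_def add_nonneg_eq_0_iff)
  have weight: "real ((2 * n - 2 * l + 2) choose (2 * k + 2)) * real ((n + 1) choose l)
        * r_coeff n (k + l)
      = inverse (C * P) * (real ((n - k) choose l)
        * (pochhammer (real k + 1 / 2) l * pochhammer (real k + 3 / 2) (n - k - l)))"
    if "l \<le> n - k" for l
    using convolution_weight_eq[OF assms that, folded P_def C_def] C nz
    by (simp add: field_simps)
  have "(\<Sum>l = j..n - k. real ((2 * n - 2 * l + 2) choose (2 * k + 2))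
          * real ((n + 1) choose l) * real (l choose j) * r_coeff n (k + l))
      = (\<Sum>l = j..n - k. inverse (C * P) * (real ((n - k) choose l) * real (l choose j)
        * (pochhammer (real k + 1 / 2) l * pochhammer (real k + 3 / 2) (n - k - l))))"
  proof (rule sum.cong[OF refl])
    fix l assume "l \<in> {j..n - k}"
    then have "l \<le> n - k" by simp
    then show "real ((2 * n - 2 * l + 2) choose (2 * k + 2))
          * real ((n + 1) choose l) * real (l choose j) * r_coeff n (k + l)
      = inverse (C * P) * (real ((n - k) choose l) * real (l choose j)
        * (pochhammer (real k + 1 / 2) l * pochhammer (real k + 3 / 2) (n - k - l)))"
      using arg_cong[OF weight, of l "\<lambda>x. x * real (l choose j)"] by (simp only: mult_ac)
  qed
  also have "\<dots> = inverse (C * P) * (real ((n - k) choose j) * P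
        * (pochhammer (real k + 1 / 2) j / pochhammer (2 * real k + 2) j))"
    using pochhammer_convolution_moment[OF j nz[unfolded P_def], of "real k + 1 / 2"]
    by (simp only: shift P_def flip: sum_distrib_left)
  also have "\<dots> = inverse C * real ((n - k) choose j)
        * (pochhammer (real k + 1 / 2) j / pochhammer (2 * real k + 2) j)"
    using nz by simp
  finally show "(\<Sum>l = j..n - k. real ((2 * n - 2 * l + 2) choose (2 * k + 2))
          * real ((n + 1) choose l) * real (l choose j) * r_coeff n (k + l))
      = inverse (4 ^ k) * ((real n + 1) / (2 * real k + 1))
          * real ((n + k + 1) choose n) * real (n choose k) * real ((n - k) choose j)
          * (pochhammer (real k + 1 / 2) j / pochhammer (2 * real k + 2) j)"
    unfolding inverse_C .
qed

end
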